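(* Let $(\hat M,\hat g,\hat J)$ be the complex cone over a Kähler manifold $(M,g,J)$, and suppose that it decomposes as a direct product of Kähler manifolds $(\hat M_i,\hat g_i,\hat J_i)$, $i=0,\dots,\ell$, so that (locally) each factor is itself a complex cone and $$\hat g=\sum_{i=0}^\ell\hat g_i=\sum_{i=0}^\ell\bigl(dr_i^2+r_i^2(\phi_i^2+g_i)\bigr).$$ Then the Kähler quotient metric $g$ of $\hat g$ (by the action of the hamiltonian Killing vector field $K=\frac12\hat J\,\mathrm{grad}_{\hat g}r^2$ on the level set $r=1$) is given by the formula $$g=\sum_{i=0}^\ell dr_i^2+\frac12\sum_{i,j=0}^\ell r_i^2r_j^2(\phi_i-\phi_j)^2+\sum_{i=0}^\ell r_i^2g_i,$$ where the right hand side is restricted to $\{r=1\}=\{\sum_i r_i^2=1\}$.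
   Context: All constructions are local. Given a Kähler manifold $(M,g,J)$ with Kähler form $\omega=g(J\cdot,\cdot)$, its complex cone is $$\hat M=\mathbb R_{>0}\times\mathbb R\times M,\qquad \hat g=dr^2+r^2(\phi^2+g),\qquad \hat J=\tfrac1r\partial_t\otimes dr-r\,\partial_r\otimes\phi+J,$$ where $r,t$ are the coordinates on $\mathbb R_{>0}$ and $\mathbb R$, $\phi=dt-\tau$ with $\tau$ a (locally defined) 1-form on $M$ satisfying $d\tau=-2\omega$, and $J$ acts on the horizontal distribution $\ker dr\cap\ker\phi\cong TM$. This is a Kähler manifold with cone vector field $\mathcal C=r\partial_r$ satisfying $\hat\nabla\mathcal C=\mathrm{Id}$. The vector field $K=\frac12\hat J\mathrm{grad}_{\hat g}r^2$ is a hamiltonian Killing field with moment map $\frac12r^2$, and $(M,g,J)$ is the Kähler quotient of $\hat M$ by $K$ on the level set $\{r=1\}$. Suppose $\hat M=\prod_{i=0}^\ell\hat M_i$, $\hat g=\sum_i\hat g_i$, $\hat J=\sum_i\hat J_i$ is a direct product of Kähler manifolds. Decomposing $\mathcal C=\sum_i\mathcal C_i$ gives cone vector fields $\mathcal C_i=r_i\partial_{r_i}$ on the factors, with $r_i=\sqrt{\hat g(\mathcal C_i,\mathcal C_i)}$, making each factor (locally, where $r_i>0$) a complex cone over a Kähler manifold $(M_i,g_i,J_i)$ with $\hat g_i=dr_i^2+r_i^2(\phi_i^2+g_i)$, where $\phi_i$ is the 1-form of that cone structure. If $\hat M_i$ has complex dimension one, then $M_i$ is a point and $g_i=0$. One has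 $r^2=\sum_ir_i^2$. The forms $\phi_i-\phi_j$ are basic (pullbacks of forms on the quotient). *)

theory Defs
  imports "HOL-Analysis.Analysis"
begin

text \<open>
  All geometry is local, so a manifold is a relatively open subset of a linear subspace \<open>V\<close>
  of a Euclidean space, and \<open>V\<close> is the tangent space at every point. Subspaces (instead of
  whole types) allow families of manifolds of different dimensions, including points
  (\<open>V = {0}\<close>). Since Frechet derivatives relative to a proper subspace are only determined
  on \<open>V\<close>, differentials are expressed through directional derivatives.
\<close>

definition dd :: "('a::real_normed_vector \<Rightarrow> 'b::real_normed_vector) \<Rightarrow> 'a \<Rightarrow> 'a \<Rightarrow> 'b" where
  "dd f x v = vector_derivative (\<lambda>s. f (x + s *\<^sub>R v)) (at (0::real))"

primrec Ck_on ::
    "nat \<Rightarrow> 'a::real_normed_vector set \<Rightarrow> 'a set \<Rightarrow> ('a \<Rightarrow> 'b::real_normed_vector) \<Rightarrow> bool" where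
  "Ck_on 0 V U f \<longleftrightarrow> continuous_on U f"
| "Ck_on (Suc k) V U f \<longleftrightarrow> f differentiable_on U \<and> (\<forall>v\<in>V. Ck_on k V U (\<lambda>x. dd f x v))"

definition smooth_on ::
    "'a::real_normed_vector set \<Rightarrow> 'a set \<Rightarrow> ('a \<Rightarrow> 'b::real_normed_vector) \<Rightarrow> bool" where
  "smooth_on V U f \<longleftrightarrow> (\<forall>k. Ck_on k V U f)"

definition lie_bracket ::
    "('a::real_normed_vector \<Rightarrow> 'a) \<Rightarrow> ('a \<Rightarrow> 'a) \<Rightarrow> 'a \<Rightarrow> 'a" where
  "lie_bracket X Y x = dd Y x (X x) - dd X x (Y x)"

definition pull1 ::
    "('a::real_normed_vector \<Rightarrow> 'b::real_normed_vector) \<Rightarrow> ('b \<Rightarrow> 'b \<Rightarrow> real) \<Rightarrow> 'a \<Rightarrow> 'a \<Rightarrow> real" where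
  "pull1 f \<alpha> x v = \<alpha> (f x) (dd f x v)"

definition pull2 ::
    "('a::real_normed_vector \<Rightarrow> 'b::real_normed_vector) \<Rightarrow> ('b \<Rightarrow> 'b \<Rightarrow> 'b \<Rightarrow> real)
      \<Rightarrow> 'a \<Rightarrow> 'a \<Rightarrow> 'a \<Rightarrow> real" where
  "pull2 f h x v w = h (f x) (dd f x v) (dd f x w)"

record 'a patch =
  model :: "'a set"
  pts :: "'a set"
  gmet :: "'a \<Rightarrow> 'a \<Rightarrow> 'a \<Rightarrow> real"
  cplx :: "'a \<Rightarrow> 'a \<Rightarrow> 'a"

definition kform :: "'a patch \<Rightarrow> 'a \<Rightarrow> 'a \<Rightarrow> 'a \<Rightarrow> real" where
  "kform M x v w = gmet M x (cplx M x v) w"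

text \<open>
  The tensors are required to be linear on the whole Euclidean space; only their values on
  \<open>model M\<close> are used, and every tensor on a subspace extends.
\<close>

definition riemannian :: "'a::euclidean_space patch \<Rightarrow> bool" where
  "riemannian M \<longleftrightarrow>
     subspace (model M) \<and> openin (top_of_set (model M)) (pts M) \<and>
     (\<forall>x\<in>pts M. bilinear (gmet M x) \<and>
        (\<forall>v\<in>model M. \<forall>w\<in>model M. gmet M x v w = gmet M x w v) \<and>
        (\<forall>v\<in>model M. v \<noteq> 0 \<longrightarrow> gmet M x v v > 0)) \<and>
     (\<forall>v\<in>model M. \<forall>w\<in>model M. smooth_on (model M) (pts M) (\<lambda>x. gmet M x v w))"

definition almost_hermitian :: "'a::euclidean_space patch \<Rightarrow> bool" where
  "almost_hermitian M \<longleftrightarrow> riemannian M \<and>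
     (\<forall>x\<in>pts M. linear (cplx M x) \<and>
        (\<forall>v\<in>model M. cplx M x v \<in> model M \<and> cplx M x (cplx M x v) = - v) \<and>
        (\<forall>v\<in>model M. \<forall>w\<in>model M. gmet M x (cplx M x v) (cplx M x w) = gmet M x v w)) \<and>
     (\<forall>v\<in>model M. smooth_on (model M) (pts M) (\<lambda>x. cplx M x v))"

definition nijenhuis ::
    "'a::euclidean_space patch \<Rightarrow> ('a \<Rightarrow> 'a) \<Rightarrow> ('a \<Rightarrow> 'a) \<Rightarrow> 'a \<Rightarrow> 'a" where
  "nijenhuis M X Y x =
     lie_bracket (\<lambda>y. cplx M y (X y)) (\<lambda>y. cplx M y (Y y)) x
     - cplx M x (lie_bracket (\<lambda>y. cplx M y (X y)) Y x)
     - cplx M x (lie_bracket X (\<lambda>y. cplx M y (Y y)) x)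
     - lie_bracket X Y x"

text \<open>
  The Nijenhuis tensor and the exterior derivative of the Kaehler form are tensorial, so it
  suffices to evaluate them on constant vector fields (whose brackets vanish).
\<close>

definition kaehler :: "'a::euclidean_space patch \<Rightarrow> bool" where
  "kaehler M \<longleftrightarrow> almost_hermitian M \<and>
     (\<forall>x\<in>pts M. \<forall>v\<in>model M. \<forall>w\<in>model M. nijenhuis M (\<lambda>_. v) (\<lambda>_. w) x = 0) \<and>
     (\<forall>x\<in>pts M. \<forall>u\<in>model M. \<forall>v\<in>model M. \<forall>w\<in>model M.
        dd (\<lambda>y. kform M y v w) x u + dd (\<lambda>y. kform M y w u) x v
          + dd (\<lambda>y. kform M y u v) x w = 0)"

definition kaehler_iso ::
    "'a::euclidean_space patch \<Rightarrow> 'b::euclidean_space patch \<Rightarrow> ('a \<Rightarrow> 'b) \<Rightarrow> bool" where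
  "kaehler_iso A B f \<longleftrightarrow>
     bij_betw f (pts A) (pts B) \<and>
     smooth_on (model A) (pts A) f \<and>
     smooth_on (model B) (pts B) (the_inv_into (pts A) f) \<and>
     (\<forall>x\<in>pts A. \<forall>v\<in>model A. \<forall>w\<in>model A. pull2 f (gmet B) x v w = gmet A x v w) \<and>
     (\<forall>x\<in>pts A. \<forall>v\<in>model A. dd f x (cplx A x v) = cplx B (f x) (dd f x v))"

definition product_patch :: "('i::finite \<Rightarrow> 'b::euclidean_space patch) \<Rightarrow> ('b ^ 'i) patch" where
  "product_patch N =
     \<lparr> model = {v. \<forall>i. v $ i \<in> model (N i)},
       pts = {y. \<forall>i. y $ i \<in> pts (N i)},
       gmet = (\<lambda>y v w. \<Sum>i\<in>UNIV. gmet (N i) (y $ i) (v $ i) (w $ i)),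
       cplx = (\<lambda>y v. \<chi> i. cplx (N i) (y $ i) (v $ i)) \<rparr>"

definition open_in_patch :: "'a::euclidean_space patch \<Rightarrow> 'a set \<Rightarrow> bool" where
  "open_in_patch M U \<longleftrightarrow> openin (top_of_set (pts M)) U"

definition restrict_patch :: "'a patch \<Rightarrow> 'a set \<Rightarrow> 'a patch" where
  "restrict_patch M U = M\<lparr>pts := U\<rparr>"

definition cone_primitive :: "'a::euclidean_space patch \<Rightarrow> ('a \<Rightarrow> 'a \<Rightarrow> real) \<Rightarrow> bool" where
  "cone_primitive M \<tau> \<longleftrightarrow>
     (\<forall>x\<in>pts M. linear (\<tau> x)) \<and>
     (\<forall>v\<in>model M. smooth_on (model M) (pts M) (\<lambda>x. \<tau> x v)) \<and>
     (\<forall>x\<in>pts M. \<forall>v\<in>model M. \<forall>w\<in>model M.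
        dd (\<lambda>y. \<tau> y w) x v - dd (\<lambda>y. \<tau> y v) x w = - 2 * kform M x v w)"

text \<open>A point of the cone is \<open>(r, t, x)\<close>; the 1-form is \<open>\<phi> = dt - \<tau>\<close>.\<close>

definition cone_form ::
    "('a \<Rightarrow> 'a \<Rightarrow> real) \<Rightarrow> real \<times> real \<times> 'a \<Rightarrow> real \<times> real \<times> 'a \<Rightarrow> real" where
  "cone_form \<tau> = (\<lambda>(r, t, x) (a, b, v). b - \<tau> x v)"

text \<open>
  The endomorphism \<open>J\<close> acts on the horizontal space through the horizontal lift
  \<open>v \<mapsto> (0, \<tau> v, v)\<close>; this contributes the summand \<open>\<tau> x (J v)\<close> in the \<open>t\<close>-direction.
\<close>

definition complex_cone ::
    "'a::euclidean_space patch \<Rightarrow> ('a \<Rightarrow> 'a \<Rightarrow> real) \<Rightarrow> (real \<times> real \<times> 'a) patch" where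
  "complex_cone M \<tau> =
     \<lparr> model = UNIV \<times> UNIV \<times> model M,
       pts = {0<..} \<times> UNIV \<times> pts M,
       gmet = (\<lambda>(r, t, x) (a, b, v) (a', b', v').
          a * a' + r\<^sup>2 * (cone_form \<tau> (r, t, x) (a, b, v) * cone_form \<tau> (r, t, x) (a', b', v')
                           + gmet M x v v')),
       cplx = (\<lambda>(r, t, x) (a, b, v).
          (- r * cone_form \<tau> (r, t, x) (a, b, v), a / r + \<tau> x (cplx M x v), cplx M x v)) \<rparr>"

definition cone_field :: "real \<times> real \<times> 'a::real_vector \<Rightarrow> real \<times> real \<times> 'a" where
  "cone_field = (\<lambda>(r, t, x). (r, 0, 0))"

definition cone_radius :: "real \<times> real \<times> 'a \<Rightarrow> real" where
  "cone_radius = (\<lambda>(r, t, x). r)"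

definition cone_base :: "real \<times> real \<times> 'a \<Rightarrow> 'a" where
  "cone_base = (\<lambda>(r, t, x). x)"

definition grad :: "'a::euclidean_space patch \<Rightarrow> ('a \<Rightarrow> real) \<Rightarrow> 'a \<Rightarrow> 'a" where
  "grad A f x = (THE v. v \<in> model A \<and> (\<forall>w\<in>model A. gmet A x v w = dd f x w))"

definition cone_K ::
    "'a::euclidean_space patch \<Rightarrow> ('a \<Rightarrow> 'a \<Rightarrow> real) \<Rightarrow> real \<times> real \<times> 'a \<Rightarrow> real \<times> real \<times> 'a" where
  "cone_K M \<tau> x = (1/2) *\<^sub>R cplx (complex_cone M \<tau>) x (grad (complex_cone M \<tau>) (\<lambda>y. (cone_radius y)\<^sup>2) x)"

text \<open>The Lie derivative of the metric along \<open>K\<close>, evaluated on constant vector fields.\<close>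

definition killing :: "'a::euclidean_space patch \<Rightarrow> ('a \<Rightarrow> 'a) \<Rightarrow> bool" where
  "killing A K \<longleftrightarrow>
     (\<forall>x\<in>pts A. K x \<in> model A) \<and> smooth_on (model A) (pts A) K \<and>
     (\<forall>x\<in>pts A. \<forall>v\<in>model A. \<forall>w\<in>model A.
        dd (\<lambda>y. gmet A y v w) x (K x)
          - gmet A x (lie_bracket K (\<lambda>_. v) x) w
          - gmet A x v (lie_bracket K (\<lambda>_. w) x) = 0)"

text \<open>With \<open>\<omega> = g(J\<cdot>,\<cdot>)\<close>, the sign is the one for which \<open>K = J grad \<mu>\<close>.\<close>

definition moment_map :: "'a::euclidean_space patch \<Rightarrow> ('a \<Rightarrow> 'a) \<Rightarrow> ('a \<Rightarrow> real) \<Rightarrow> bool" where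
  "moment_map A K \<mu> \<longleftrightarrow>
     smooth_on (model A) (pts A) \<mu> \<and>
     (\<forall>x\<in>pts A. \<forall>v\<in>model A. kform A x (K x) v = - dd \<mu> x v)"

definition level_set :: "'a patch \<Rightarrow> ('a \<Rightarrow> real) \<Rightarrow> real \<Rightarrow> 'a set" where
  "level_set A \<mu> c = {x \<in> pts A. \<mu> x = c}"

definition level_tangent ::
    "'a::euclidean_space patch \<Rightarrow> ('a \<Rightarrow> real) \<Rightarrow> 'a \<Rightarrow> 'a set" where
  "level_tangent A \<mu> x = {v \<in> model A. dd \<mu> x v = 0}"

definition level_horizontal ::
    "'a::euclidean_space patch \<Rightarrow> ('a \<Rightarrow> 'a) \<Rightarrow> ('a \<Rightarrow> real) \<Rightarrow> 'a \<Rightarrow> 'a set" where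
  "level_horizontal A K \<mu> x = {v \<in> level_tangent A \<mu> x. gmet A x v (K x) = 0}"

definition same_orbit ::
    "'a::euclidean_space patch \<Rightarrow> ('a \<Rightarrow> 'a) \<Rightarrow> 'a \<Rightarrow> 'a \<Rightarrow> bool" where
  "same_orbit A K x y \<longleftrightarrow>
     (\<exists>\<gamma> b. \<gamma> 0 = x \<and> \<gamma> b = y \<and>
        (\<forall>s\<in>closed_segment 0 (b::real). \<gamma> s \<in> pts A \<and>
           (\<gamma> has_vector_derivative K (\<gamma> s)) (at s within closed_segment 0 b)))"

text \<open>
  \<open>B\<close> is the Kaehler quotient of \<open>A\<close> by \<open>K\<close> on the level set \<open>\<mu> = c\<close>, with quotient map
  (the restriction to the level set of) \<open>q\<close>: the fibres are the orbits of \<open>K\<close>, and the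
  horizontal spaces are mapped isometrically and complex linearly onto the tangent spaces of \<open>B\<close>.
\<close>

definition kaehler_quotient ::
    "'a::euclidean_space patch \<Rightarrow> ('a \<Rightarrow> 'a) \<Rightarrow> ('a \<Rightarrow> real) \<Rightarrow> real
      \<Rightarrow> ('a \<Rightarrow> 'b::euclidean_space) \<Rightarrow> 'b patch \<Rightarrow> bool" where
  "kaehler_quotient A K \<mu> c q B \<longleftrightarrow>
     killing A K \<and> moment_map A K \<mu> \<and>
     (\<forall>x\<in>level_set A \<mu> c. K x \<noteq> 0) \<and>
     smooth_on (model A) (pts A) q \<and>
     q ` level_set A \<mu> c = pts B \<and>
     (\<forall>x\<in>level_set A \<mu> c. \<forall>y\<in>level_set A \<mu> c. q x = q y \<longleftrightarrow> same_orbit A K x y) \<and>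
     (\<forall>x\<in>level_set A \<mu> c.
        dd q x ` level_horizontal A K \<mu> x = model B \<and>
        (\<forall>v\<in>level_horizontal A K \<mu> x.
           cplx B (q x) (dd q x v) = dd q x (cplx A x v) \<and>
           (\<forall>w\<in>level_horizontal A K \<mu> x.
              gmet B (q x) (dd q x v) (dd q x w) = gmet A x v w)))"

text \<open>
  The component \<open>\<C>\<^sub>i\<close> of the cone vector field under a decomposition \<open>p\<close> of (an open part of)
  the cone, as a tangent vector of the \<open>i\<close>-th factor, and its length \<open>r\<^sub>i\<close>.
\<close>

definition factor_field ::
    "(real \<times> real \<times> 'a::euclidean_space \<Rightarrow> 'b::euclidean_space ^ 'i::finite) \<Rightarrow> 'i
      \<Rightarrow> real \<times> real \<times> 'a \<Rightarrow> 'b" where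
  "factor_field p i x = dd p x (cone_field x) $ i"

definition factor_radius ::
    "('i::finite \<Rightarrow> 'b::euclidean_space patch)
      \<Rightarrow> (real \<times> real \<times> 'a::euclidean_space \<Rightarrow> 'b ^ 'i) \<Rightarrow> 'i \<Rightarrow> real \<times> real \<times> 'a \<Rightarrow> real" where
  "factor_radius N p i x =
     sqrt (gmet (N i) (p x $ i) (factor_field p i x) (factor_field p i x))"

end

theory Submission
  imports Defs
begin

text \<open>
  The cone metric at \<open>r = 1\<close>, restricted to vectors tangent to the level set, is
  \<open>\<phi>\<^sup>2 + g\<close>, while the product decomposition gives \<open>\<Sum>i. dr\<^sub>i\<^sup>2 + r\<^sub>i\<^sup>2 (\<phi>\<^sub>i\<^sup>2 + g\<^sub>i)\<close>.
  The decomposition is holomorphic and maps the cone field to the sum of the cone fields,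
  hence \<open>K = J \<C>\<close> to the sum of the \<open>K\<^sub>i\<close>; pairing the metric with \<open>K\<close>
  yields \<open>r\<^sup>2 \<phi> = \<Sum>i. r\<^sub>i\<^sup>2 \<phi>\<^sub>i\<close>. So \<open>g\<close> contains the variance
  \<open>\<Sum>i. r\<^sub>i\<^sup>2 \<phi>\<^sub>i\<^sup>2 - (\<Sum>i. r\<^sub>i\<^sup>2 \<phi>\<^sub>i)\<^sup>2\<close> of the \<open>\<phi>\<^sub>i\<close> with weights \<open>r\<^sub>i\<^sup>2\<close> of sum 1, which
  is half the weighted sum of the squared differences.
\<close>

section \<open>Directional derivatives on relatively open sets\<close>

text \<open>\<open>U\<close> may have empty interior in the ambient space, but a line through
  \<open>x\<close> in a direction of \<open>V\<close> stays in \<open>V\<close> and meets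
  \<open>U\<close> in an open set of parameters. Thus the two-sided derivative in \<open>dd\<close>
  only sees points of \<open>U\<close> near 0.\<close>

lemma open_line_preimage:
  fixes V :: "'a::real_normed_vector set"
  assumes V: "subspace V" "openin (top_of_set V) U"
    and xv: "x \<in> U" "v \<in> V"
  shows "open ((\<lambda>s::real. x + s *\<^sub>R v) -` U)"
proof -
  let ?h = "\<lambda>s::real. x + s *\<^sub>R v"
  have "x \<in> V" using V(2) xv(1) openin_imp_subset by blast
  then have "?h \<in> UNIV \<rightarrow> V" using V(1) xv(2) by (auto simp: subspace_add subspace_scale)
  moreover have "continuous_on UNIV ?h" by (intro continuous_intros)
  ultimately have "openin (top_of_set UNIV) (UNIV \<inter> ?h -` U)"
    using continuous_openin_preimage[of UNIV ?h V U] V(2) by blast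
  then show ?thesis by simp
qed

lemma has_vector_derivative_dd:
  assumes V: "subspace V" "openin (top_of_set V) U"
    and xv: "x \<in> U" "v \<in> V"
    and D: "(f has_derivative D) (at x within U)"
  shows "((\<lambda>s. f (x + s *\<^sub>R v)) has_vector_derivative D v) (at 0)"
proof -
  let ?h = "\<lambda>s::real. x + s *\<^sub>R v"
  let ?S = "?h -` U"
  have S: "open ?S" using open_line_preimage[OF V xv] .
  have h: "(?h has_derivative (\<lambda>s. s *\<^sub>R v)) (at 0 within ?S)"
    by (auto intro!: derivative_eq_intros)
  have "(f has_derivative D) (at (?h 0) within ?h ` ?S)"
    using D by (auto intro: has_derivative_subset)
  from has_derivative_in_compose[OF h this]
  have "((\<lambda>s. f (?h s)) has_derivative (\<lambda>s. D (s *\<^sub>R v))) (at 0 within ?S)" .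
  moreover have "at 0 within ?S = at 0" using xv(1) by (intro at_within_open S) simp
  moreover have "(\<lambda>s. D (s *\<^sub>R v)) = (\<lambda>s. s *\<^sub>R D v)"
    by (simp add: linear_cmul[OF has_derivative_linear[OF D]])
  ultimately show ?thesis by (simp add: has_vector_derivative_def)
qed

text \<open>A derivative within \<open>U\<close> may be ambiguous off \<open>V\<close>;
  \<open>dd\<close> reads off its values on \<open>V\<close>, which every choice of \<open>D\<close>
  shares.\<close>

lemma dd_eq:
  assumes "subspace V" "openin (top_of_set V) U" "x \<in> U" "v \<in> V"
    and "(f has_derivative D) (at x within U)"
  shows "dd f x v = D v"
  unfolding dd_def using has_vector_derivative_dd[OF assms] by (rule vector_derivative_at)

lemma dd_at:
  assumes "(f has_derivative D) (at x)"
  shows "dd f x v = D v"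
  using dd_eq[OF subspace_UNIV, of UNIV x v f D] assms by simp

lemma dd_linear: "bounded_linear f \<Longrightarrow> dd f x v = f v"
  by (rule dd_at) (rule bounded_linear_imp_has_derivative)

lemma dd_const: "dd (\<lambda>_. c) x v = 0"
  by (simp add: dd_def)

text \<open>Identities valid only at points of the manifold can still be differentiated in tangent
  directions, because the line remains in \<open>U\<close> for small parameters.\<close>

lemma dd_cong_on:
  assumes V: "subspace V" "openin (top_of_set V) U"
    and xv: "x \<in> U" "v \<in> V"
    and eq: "\<And>y. y \<in> U \<Longrightarrow> f y = g y"
  shows "dd f x v = dd g x v"
proof -
  let ?h = "\<lambda>s::real. x + s *\<^sub>R v"
  have "eventually (\<lambda>s. s \<in> ?h -` U) (nhds 0)"
    using xv(1) by (intro eventually_nhds_in_open open_line_preimage[OF V xv]) auto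
  then have "eventually (\<lambda>s. s \<in> UNIV \<longrightarrow> f (?h s) = g (?h s)) (nhds 0)"
    by eventually_elim (simp add: eq)
  then show ?thesis unfolding dd_def
    by (intro vector_derivative_cong_eq) auto
qed

text \<open>For \<open>y\<close> orthogonal to \<open>W\<close> the function
  \<open>y \<bullet> f z\<close> vanishes on \<open>U\<close>, hence so does its derivative, and
  \<open>D v\<close> has no component orthogonal to \<open>W\<close>. This shows that differentials
  take tangent vectors to tangent vectors, which \<open>kaehler_iso\<close> does not state
  explicitly.\<close>

lemma dd_mem_subspace:
  fixes f :: "'a::real_normed_vector \<Rightarrow> 'b::euclidean_space"
  assumes V: "subspace V" "openin (top_of_set V) U"
    and xv: "x \<in> U" "v \<in> V"
    and f: "f differentiable_on U"
    and W: "subspace W" "f ` U \<subseteq> W"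
  shows "dd f x v \<in> W"
proof -
  obtain D where D: "(f has_derivative D) (at x within U)"
    using f xv(1) unfolding differentiable_on_def differentiable_def by blast
  have ortho: "y \<bullet> D v = 0" if y: "\<forall>w\<in>W. y \<bullet> w = 0" for y
  proof -
    have "((\<lambda>z. y \<bullet> f z) has_derivative (\<lambda>v. y \<bullet> D v)) (at x within U)"
      using D by (rule has_derivative_inner_right)
    then have "dd (\<lambda>z. y \<bullet> f z) x v = y \<bullet> D v" by (rule dd_eq[OF V xv])
    moreover have "dd (\<lambda>z. y \<bullet> f z) x v = dd (\<lambda>_. 0) x v"
      using W(2) y by (intro dd_cong_on[OF V xv]) auto
    ultimately show ?thesis by (simp add: dd_const)
  qed
  obtain a b where ab: "a \<in> span W" "\<And>w. w \<in> span W \<Longrightarrow> orthogonal b w" "D v = a + b"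
    using orthogonal_subspace_decomp_exists[of W "D v"] by metis
  have "b \<bullet> D v = 0"
    using ab(2) span_base by (intro ortho) (auto simp: orthogonal_def)
  moreover have "b \<bullet> a = 0" using ab(1,2) by (auto simp: orthogonal_def)
  ultimately have "b = 0" using ab(3) by (simp add: inner_add_right)
  then show ?thesis using ab W(1) dd_eq[OF V xv D] by (simp add: span_eq_iff[THEN iffD2])
qed

text \<open>Chain rule for a component of \<open>p\<close> followed by a factor chart. Membership in
  \<open>W\<close> comes along because the derivative of \<open>h\<close> within \<open>T\<close> is
  identified with \<open>dd h\<close> only on \<open>W\<close>.\<close>

lemma has_derivative_componentwise_compose:
  fixes f :: "'a::real_normed_vector \<Rightarrow> 'b::euclidean_space ^ 'i::finite"
  assumes V: "subspace V" "openin (top_of_set V) U"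
    and W: "subspace W" "openin (top_of_set W) T"
    and xv: "x \<in> U"
    and f: "f differentiable_on U" "\<And>y. y \<in> U \<Longrightarrow> f y $ i \<in> T"
    and h: "h differentiable_on T"
  obtains D where "((\<lambda>y. h (f y $ i)) has_derivative D) (at x within U)"
    "\<And>v. v \<in> V \<Longrightarrow> dd f x v $ i \<in> W"
    "\<And>v. v \<in> V \<Longrightarrow> D v = dd h (f x $ i) (dd f x v $ i)"
proof -
  obtain A where A: "(f has_derivative A) (at x within U)"
    using f(1) xv unfolding differentiable_on_def differentiable_def by blast
  obtain B where B: "(h has_derivative B) (at (f x $ i) within T)"
    using h f(2)[OF xv] unfolding differentiable_on_def differentiable_def by blast
  have Ai: "((\<lambda>y. f y $ i) has_derivative (\<lambda>v. A v $ i)) (at x within U)"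
    using A by (rule bounded_linear.has_derivative[OF bounded_linear_vec_nth])
  have "(h has_derivative B) (at (f x $ i) within (\<lambda>y. f y $ i) ` U)"
    using f(2) by (intro has_derivative_subset[OF B]) auto
  from has_derivative_in_compose[OF Ai this]
  have 1: "((\<lambda>y. h (f y $ i)) has_derivative (\<lambda>v. B (A v $ i))) (at x within U)" .
  have diff: "(\<lambda>y. f y $ i) differentiable_on U"
    unfolding differentiable_on_def
  proof
    fix z assume "z \<in> U"
    then obtain B where "(f has_derivative B) (at z within U)"
      using f(1) unfolding differentiable_on_def differentiable_def by blast
    then have "((\<lambda>y. f y $ i) has_derivative (\<lambda>v. B v $ i)) (at z within U)"
      by (rule bounded_linear.has_derivative[OF bounded_linear_vec_nth])
    then show "(\<lambda>y. f y $ i) differentiable (at z within U)" by (rule differentiableI)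
  qed
  have im: "(\<lambda>y. f y $ i) ` U \<subseteq> W"
    using f(2) openin_imp_subset[OF W(2)] by blast
  have Av: "A v = dd f x v" if "v \<in> V" for v
    using dd_eq[OF V xv that A] by simp
  have 2: "dd f x v $ i \<in> W" if "v \<in> V" for v
    using dd_mem_subspace[OF V xv that diff W(1) im] dd_eq[OF V xv that Ai] Av[OF that] by simp
  have 3: "B (A v $ i) = dd h (f x $ i) (dd f x v $ i)" if "v \<in> V" for v
    using dd_eq[OF W f(2)[OF xv] 2[OF that] B] Av[OF that] by simp
  show ?thesis using that[OF 1 2 3] .
qed

section \<open>Smoothness through iterated directional derivatives\<close>

lemma Ck_on_cong:
  assumes "subspace V" "openin (top_of_set V) U" "\<And>y. y \<in> U \<Longrightarrow> f y = g y" "Ck_on k V U f"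
  shows "Ck_on k V U g"
  using assms(3,4)
proof (induction k arbitrary: f g)
  case 0
  then show ?case using continuous_on_cong[of U U f g] by auto
next
  case (Suc k)
  have "g differentiable_on U"
    unfolding differentiable_on_def
  proof
    fix z assume z: "z \<in> U"
    then obtain D where "(f has_derivative D) (at z within U)"
      using Suc.prems(2) unfolding Ck_on.simps differentiable_on_def differentiable_def by blast
    then have "(g has_derivative D) (at z within U)"
      using has_derivative_transform[OF z, of g f] Suc.prems(1) by simp
    then show "g differentiable (at z within U)" by (rule differentiableI)
  qed
  moreover have "Ck_on k V U (\<lambda>x. dd g x v)" if "v \<in> V" for v
  proof (rule Suc.IH)
    show "dd f y v = dd g y v" if "y \<in> U" for y
      using dd_cong_on[OF assms(1,2) that \<open>v \<in> V\<close> Suc.prems(1)] .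
    show "Ck_on k V U (\<lambda>x. dd f x v)"
      using Suc.prems(2) \<open>v \<in> V\<close> by simp
  qed
  ultimately show ?case by simp
qed

lemma Ck_on_const: "Ck_on k V U (\<lambda>_. c)"
  by (induction k arbitrary: c) (simp_all add: dd_const)

lemma smooth_on_linear: "bounded_linear f \<Longrightarrow> smooth_on V U f"
  unfolding smooth_on_def
proof
  fix k
  assume f: "bounded_linear f"
  then show "Ck_on k V U f"
    by (cases k) (auto simp: linear_continuous_on dd_linear Ck_on_const
        intro: bounded_linear_imp_differentiable_on)
qed

text \<open>Meant for \<open>cone_K\<close>, which is known to be constant only at the points of the
  cone.\<close>

lemma smooth_on_cong_const:
  assumes "subspace V" "openin (top_of_set V) U" "\<And>y. y \<in> U \<Longrightarrow> f y = c"
  shows "smooth_on V U f"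
  unfolding smooth_on_def using Ck_on_cong[OF assms(1,2) _ Ck_on_const, of c f] assms(3) by auto

lemma smooth_on_imp_differentiable_on: "smooth_on V U f \<Longrightarrow> f differentiable_on U"
  unfolding smooth_on_def by (metis Ck_on.simps(2))

section \<open>The complex cone and its quotient\<close>

lemma kaehler_imp_patch:
  assumes "kaehler M"
  shows "subspace (model M)" "openin (top_of_set (model M)) (pts M)"
  using assms by (auto simp: kaehler_def almost_hermitian_def riemannian_def)

lemma complex_cone_patch:
  assumes "kaehler M"
  shows "subspace (model (complex_cone M \<tau>))"
    "openin (top_of_set (model (complex_cone M \<tau>))) (pts (complex_cone M \<tau>))"
proof -
  show "subspace (model (complex_cone M \<tau>))"
    using kaehler_imp_patch(1)[OF assms]
    by (auto simp: complex_cone_def intro!: subspace_Times)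
  have "openin (top_of_set (UNIV::real set)) {0<..}" by simp
  then show "openin (top_of_set (model (complex_cone M \<tau>))) (pts (complex_cone M \<tau>))"
    using kaehler_imp_patch(2)[OF assms]
    by (auto simp: complex_cone_def intro!: openin_Times)
qed

section \<open>Cone coordinates and their differentials\<close>

lemma cone_radius_eq: "cone_radius = fst"
  by (auto simp: cone_radius_def)

lemma cone_base_eq: "cone_base = (\<lambda>x. snd (snd x))"
  by (auto simp: cone_base_def)

lemma dd_cone_radius: "dd cone_radius x v = fst v"
  unfolding cone_radius_eq by (rule dd_linear) (rule bounded_linear_fst)

lemma bounded_linear_cone_base: "bounded_linear cone_base"
  unfolding cone_base_eq by (intro bounded_linear_intros)

lemma dd_cone_base: "dd cone_base x v = snd (snd v)"
  using dd_linear[OF bounded_linear_cone_base] by (simp add: cone_base_eq)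

lemma dd_cone_radius_sq: "dd (\<lambda>x. (cone_radius x)\<^sup>2) x v = 2 * fst x * fst v"
  unfolding cone_radius_eq by (rule dd_at) (auto intro!: derivative_eq_intros)

lemma dd_half_cone_radius_sq: "dd (\<lambda>x. (cone_radius x)\<^sup>2 / 2) x v = fst x * fst v"
  unfolding cone_radius_eq by (rule dd_at) (auto intro!: derivative_eq_intros)

text \<open>Each directional derivative is \<open>fst x\<close> times a constant, so after one
  differentiation the linear case applies.\<close>

lemma smooth_half_cone_radius_sq: "smooth_on V U (\<lambda>x. (cone_radius x)\<^sup>2 / 2)"
  unfolding smooth_on_def
proof
  fix k
  have d: "(\<lambda>x::real \<times> real \<times> 'a. (cone_radius x)\<^sup>2 / 2) differentiable_on U"
    unfolding differentiable_on_def differentiable_def cone_radius_eq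
    by (auto intro!: derivative_eq_intros)
  have "bounded_linear (\<lambda>x::real \<times> real \<times> 'a. fst x * a)" for a
    by (intro bounded_linear_intros)
  then show "Ck_on k V U (\<lambda>x. (cone_radius x)\<^sup>2 / 2)"
    using d differentiable_imp_continuous_on[OF d] smooth_on_linear[of _ V U]
    by (cases k) (auto simp: dd_half_cone_radius_sq smooth_on_def)
qed

lemma gmet_cone:
  "gmet (complex_cone M \<tau>) x v w =
     fst v * fst w + (fst x)\<^sup>2 * (cone_form \<tau> x v * cone_form \<tau> x w
       + gmet M (snd (snd x)) (snd (snd v)) (snd (snd w)))"
  by (auto simp: complex_cone_def split: prod.splits)

lemma cone_form_eq: "cone_form \<tau> x v = fst (snd v) - \<tau> (snd (snd x)) (snd (snd v))"
  by (auto simp: cone_form_def split: prod.splits)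

lemma kaehler_bilinear: "kaehler M \<Longrightarrow> x \<in> pts M \<Longrightarrow> bilinear (gmet M x)"
  by (auto simp: kaehler_def almost_hermitian_def riemannian_def)

lemma kaehler_zero:
  assumes "kaehler M" "x \<in> pts M"
  shows "gmet M x 0 v = 0" "gmet M x v 0 = 0" "cplx M x 0 = 0"
proof -
  show "gmet M x 0 v = 0" "gmet M x v 0 = 0"
    using kaehler_bilinear[OF assms] by (auto simp: bilinear_lzero bilinear_rzero)
  show "cplx M x 0 = 0"
    using assms by (auto simp: kaehler_def almost_hermitian_def linear_0)
qed

lemma cone_primitive_zero: "cone_primitive M \<tau> \<Longrightarrow> x \<in> pts M \<Longrightarrow> \<tau> x 0 = 0"
  by (auto simp: cone_primitive_def linear_0)

lemma mem_pts_cone: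
  "x \<in> pts (complex_cone M \<tau>) \<longleftrightarrow> fst x > 0 \<and> snd (snd x) \<in> pts M"
  by (cases x) (auto simp: complex_cone_def)

lemma mem_model_cone: "v \<in> model (complex_cone M \<tau>) \<longleftrightarrow> snd (snd v) \<in> model M"
  by (cases v) (auto simp: complex_cone_def)

section \<open>The field \<open>K\<close> on the cone and its quotient\<close>

context
  fixes M :: "'a::euclidean_space patch" and \<tau>
  assumes M: "kaehler M" and \<tau>: "cone_primitive M \<tau>"
begin

text \<open>For \<open>a = fst x\<close> this says that the complex structure sends the cone field
  to \<open>(0, 1, 0)\<close>, that is, to \<open>K\<close>.\<close>

lemma cplx_cone_radial:
  assumes "x \<in> pts (complex_cone M \<tau>)"
  shows "cplx (complex_cone M \<tau>) x (a, 0, 0) = (0, a / fst x, 0)"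
  using assms kaehler_zero[OF M] cone_primitive_zero[OF \<tau>]
  by (cases x) (auto simp: complex_cone_def cone_form_def)

lemma cplx_cone_vertical:
  assumes "x \<in> pts (complex_cone M \<tau>)"
  shows "cplx (complex_cone M \<tau>) x (0, b, 0) = (- fst x * b, 0, 0)"
  using assms kaehler_zero[OF M] cone_primitive_zero[OF \<tau>]
  by (cases x) (auto simp: complex_cone_def cone_form_def)

lemma gmet_cone_radial:
  assumes "x \<in> pts (complex_cone M \<tau>)"
  shows "gmet (complex_cone M \<tau>) x (a, 0, 0) w = a * fst w"
  using assms kaehler_zero[OF M] cone_primitive_zero[OF \<tau>]
  by (auto simp: gmet_cone cone_form_eq mem_pts_cone)

text \<open>For \<open>b = 1\<close> the pairing with \<open>K\<close> recovers
  \<open>r\<^sup>2 \<phi>\<close>; this is how the 1-forms of the cone and of its factors get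
  compared.\<close>

lemma gmet_cone_vertical:
  assumes "x \<in> pts (complex_cone M \<tau>)"
  shows "gmet (complex_cone M \<tau>) x v (0, b, 0) = (fst x)\<^sup>2 * cone_form \<tau> x v * b"
  using assms kaehler_zero[OF M] cone_primitive_zero[OF \<tau>]
  by (auto simp: gmet_cone cone_form_eq mem_pts_cone)

text \<open>The difference of \<open>v\<close> and \<open>v'\<close> has length zero. Its squared
  length is a sum of nonnegative terms with \<open>r > 0\<close>, so the radial part, the value of
  the 1-form and the base part all vanish. This gives the uniqueness that the definite description
  in \<open>grad\<close> requires.\<close>

lemma gmet_cone_nondegenerate:
  assumes x: "x \<in> pts (complex_cone M \<tau>)"
    and v: "v \<in> model (complex_cone M \<tau>)" "v' \<in> model (complex_cone M \<tau>)"
    and eq: "\<And>w. w \<in> model (complex_cone M \<tau>) \<Longrightarrow>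
      gmet (complex_cone M \<tau>) x v w = gmet (complex_cone M \<tau>) x v' w"
  shows "v = v'"
proof -
  let ?d = "v - v'" and ?y = "snd (snd x)"
  have y: "fst x > 0" "?y \<in> pts M" using x by (auto simp: mem_pts_cone)
  have d: "?d \<in> model (complex_cone M \<tau>)"
    by (intro subspace_diff complex_cone_patch(1)[OF M] v)
  have bil: "bilinear (gmet M ?y)" using kaehler_bilinear[OF M y(2)] .
  have lin: "linear (\<tau> ?y)" using \<tau> y by (auto simp: cone_primitive_def)
  have "gmet (complex_cone M \<tau>) x ?d ?d
      = gmet (complex_cone M \<tau>) x v ?d - gmet (complex_cone M \<tau>) x v' ?d"
    by (simp add: gmet_cone cone_form_eq bilinear_lsub[OF bil] linear_diff[OF lin])
      (simp add: algebra_simps)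
  then have "gmet (complex_cone M \<tau>) x ?d ?d = 0" using eq[OF d] by simp
  then have z: "fst ?d * fst ?d + (fst x)\<^sup>2 * (cone_form \<tau> x ?d * cone_form \<tau> x ?d
       + gmet M ?y (snd (snd ?d)) (snd (snd ?d))) = 0" by (simp only: gmet_cone)
  have pos: "w \<noteq> 0 \<Longrightarrow> w \<in> model M \<Longrightarrow> gmet M ?y w w > 0" for w
    using M y(2) by (auto simp: kaehler_def almost_hermitian_def riemannian_def)
  have mem: "snd (snd ?d) \<in> model M" using d by (simp only: mem_model_cone)
  have ge: "gmet M ?y (snd (snd ?d)) (snd (snd ?d)) \<ge> 0"
    using pos[OF _ mem] kaehler_zero[OF M y(2)] by (cases "snd (snd ?d) = 0") (auto simp: less_imp_le)
  have "fst ?d * fst ?d = 0 \<and> cone_form \<tau> x ?d * cone_form \<tau> x ?d = 0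
      \<and> gmet M ?y (snd (snd ?d)) (snd (snd ?d)) = 0"
    using z ge y(1) by (auto simp: add_nonneg_eq_0_iff simp del: fst_diff snd_diff)
  then have "fst ?d = 0" "cone_form \<tau> x ?d = 0" "snd (snd ?d) = 0"
    using pos[OF _ mem] by (auto simp del: fst_diff snd_diff)
  then have "?d = 0"
    using cone_primitive_zero[OF \<tau> y(2)]
    by (simp add: cone_form_eq prod_eq_iff)
  then show ?thesis by simp
qed

text \<open>The gradient of \<open>r\<^sup>2\<close> is twice the cone field, which the complex
  structure turns into twice the coordinate field of \<open>t\<close>.\<close>

lemma cone_K_eq:
  assumes x: "x \<in> pts (complex_cone M \<tau>)"
  shows "cone_K M \<tau> x = (0, 1, 0)"
proof -
  have m: "(2 * fst x, 0, 0) \<in> model (complex_cone M \<tau>)"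
    using kaehler_imp_patch(1)[OF M] by (simp add: mem_model_cone subspace_0)
  have "grad (complex_cone M \<tau>) (\<lambda>y. (cone_radius y)\<^sup>2) x = (2 * fst x, 0, 0)"
    unfolding grad_def
  proof (rule the_equality)
    show "v = (2 * fst x, 0, 0)"
      if "v \<in> model (complex_cone M \<tau>) \<and> (\<forall>w\<in>model (complex_cone M \<tau>).
        gmet (complex_cone M \<tau>) x v w = dd (\<lambda>y. (cone_radius y)\<^sup>2) x w)" for v
      using that m gmet_cone_radial[OF x]
      by (intro gmet_cone_nondegenerate[OF x]) (auto simp: dd_cone_radius_sq)
  qed (use m gmet_cone_radial[OF x] in \<open>auto simp: dd_cone_radius_sq\<close>)
  then show ?thesis
    using x by (simp add: cone_K_def cplx_cone_radial[OF x] mem_pts_cone)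
qed

text \<open>\<open>K\<close> is constant on the cone, so its brackets with constant fields vanish,
  and the metric coefficients do not depend on \<open>t\<close>.\<close>

lemma killing_cone_K: "killing (complex_cone M \<tau>) (cone_K M \<tau>)"
  unfolding killing_def
proof (intro conjI ballI)
  note C = complex_cone_patch[OF M, of \<tau>]
  show "cone_K M \<tau> x \<in> model (complex_cone M \<tau>)" if "x \<in> pts (complex_cone M \<tau>)" for x
    using kaehler_imp_patch(1)[OF M] by (simp add: cone_K_eq[OF that] mem_model_cone subspace_0)
  show "smooth_on (model (complex_cone M \<tau>)) (pts (complex_cone M \<tau>)) (cone_K M \<tau>)"
    by (rule smooth_on_cong_const[OF C cone_K_eq])
  fix x v w
  assume x: "x \<in> pts (complex_cone M \<tau>)"
    and v: "v \<in> model (complex_cone M \<tau>)" and w: "w \<in> model (complex_cone M \<tau>)"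
  have "dd (cone_K M \<tau>) x u = 0" if "u \<in> model (complex_cone M \<tau>)" for u
    using dd_cong_on[OF C x that cone_K_eq] by (simp add: dd_const)
  then have L: "lie_bracket (cone_K M \<tau>) (\<lambda>_. u) x = 0" if "u \<in> model (complex_cone M \<tau>)" for u
    using that by (simp add: lie_bracket_def dd_const)
  have "dd (\<lambda>y. gmet (complex_cone M \<tau>) y v w) x (cone_K M \<tau> x) = 0"
    by (simp add: cone_K_eq[OF x] dd_def gmet_cone cone_form_eq)
  moreover have "gmet (complex_cone M \<tau>) x 0 w = 0" "gmet (complex_cone M \<tau>) x v 0 = 0"
    using x gmet_cone_radial[OF x, of 0 w] gmet_cone_vertical[OF x, of v 0]
    by (simp_all add: zero_prod_def)
  ultimately show "dd (\<lambda>y. gmet (complex_cone M \<tau>) y v w) x (cone_K M \<tau> x)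
      - gmet (complex_cone M \<tau>) x (lie_bracket (cone_K M \<tau>) (\<lambda>_. v) x) w
      - gmet (complex_cone M \<tau>) x v (lie_bracket (cone_K M \<tau>) (\<lambda>_. w) x) = 0"
    using L v w by simp
qed

text \<open>The complex structure sends \<open>K\<close> to minus the cone field, whose metric dual
  is \<open>r dr\<close>, the differential of \<open>r\<^sup>2 / 2\<close>.\<close>

lemma moment_map_cone_K:
  "moment_map (complex_cone M \<tau>) (cone_K M \<tau>) (\<lambda>x. (cone_radius x)\<^sup>2 / 2)"
  unfolding moment_map_def kform_def
  by (simp add: smooth_half_cone_radius_sq cone_K_eq cplx_cone_vertical gmet_cone_radial
      dd_half_cone_radius_sq)

lemma same_orbit_cone_K:
  assumes x: "x \<in> pts (complex_cone M \<tau>)" and y: "y \<in> pts (complex_cone M \<tau>)"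
    and "fst x = fst y"
  shows "same_orbit (complex_cone M \<tau>) (cone_K M \<tau>) x y \<longleftrightarrow> cone_base x = cone_base y"
proof
  assume "cone_base x = cone_base y"
  then have xy: "y = (fst x, fst (snd y), snd (snd x))"
    using assms(3) by (simp add: cone_base_eq prod_eq_iff)
  \<comment> \<open>The integral curve of \<open>K\<close> translates \<open>t\<close>; the end
    parameter is the difference of the \<open>t\<close>-coordinates, possibly negative.\<close>
  let ?g = "\<lambda>s. (fst x, fst (snd x) + s, snd (snd x))"
  have pts: "?g s \<in> pts (complex_cone M \<tau>)" for s using x by (simp add: mem_pts_cone)
  have "(?g has_vector_derivative cone_K M \<tau> (?g s)) (at s within S)" for s S
    unfolding cone_K_eq[OF pts] by (auto intro!: derivative_eq_intros)
  then show "same_orbit (complex_cone M \<tau>) (cone_K M \<tau>) x y"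
    unfolding same_orbit_def using pts xy
    by (intro exI[of _ ?g] exI[of _ "fst (snd y) - fst (snd x)"]) (simp add: prod_eq_iff)
next
  assume "same_orbit (complex_cone M \<tau>) (cone_K M \<tau>) x y"
  then obtain \<gamma> b where g: "\<gamma> 0 = x" "\<gamma> b = y"
    and d: "\<And>s. s \<in> closed_segment 0 (b::real) \<Longrightarrow> \<gamma> s \<in> pts (complex_cone M \<tau>)"
      "\<And>s. s \<in> closed_segment 0 b \<Longrightarrow>
        (\<gamma> has_vector_derivative cone_K M \<tau> (\<gamma> s)) (at s within closed_segment 0 b)"
    unfolding same_orbit_def by blast
  \<comment> \<open>\<open>K\<close> has no base component, so every integral curve projects to a
    constant curve on the segment.\<close>
  have "((\<lambda>s. cone_base (\<gamma> s)) has_vector_derivative 0) (at s within closed_segment 0 b)"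
    if s: "s \<in> closed_segment 0 b" for s
    using bounded_linear.has_vector_derivative[OF bounded_linear_cone_base d(2)[OF s]]
      cone_K_eq[OF d(1)[OF s]] by (simp add: cone_base_def)
  then obtain c where "\<And>s. s \<in> closed_segment 0 b \<Longrightarrow> cone_base (\<gamma> s) = c"
    using has_vector_derivative_zero_constant[OF convex_closed_segment] by metis
  then show "cone_base x = cone_base y" using g by (metis ends_in_segment)
qed

text \<open>Tangency removes the radial component because \<open>r > 0\<close>, and orthogonality to
  \<open>K\<close> forces the 1-form to vanish. What remains are the horizontal lifts of base
  vectors.\<close>

lemma level_horizontal_cone:
  assumes x: "x \<in> pts (complex_cone M \<tau>)"
  shows "level_horizontal (complex_cone M \<tau>) (cone_K M \<tau>) (\<lambda>x. (cone_radius x)\<^sup>2 / 2) x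
    = (\<lambda>u. (0, \<tau> (snd (snd x)) u, u)) ` model M"
  using x by (force simp: level_horizontal_def level_tangent_def dd_half_cone_radius_sq
      cone_K_eq gmet_cone_vertical mem_model_cone mem_pts_cone cone_form_eq)

text \<open>On horizontal lifts at \<open>r = 1\<close> the cone metric reduces to that of
  \<open>M\<close>, and the complex structure lifts the one of \<open>M\<close>. The value 1/2 of
  the moment map selects \<open>r = 1\<close> since the radius is positive.\<close>

lemma kaehler_quotient_cone:
  "kaehler_quotient (complex_cone M \<tau>) (cone_K M \<tau>) (\<lambda>x. (cone_radius x)\<^sup>2 / 2) (1/2) cone_base M"
proof -
  let ?C = "complex_cone M \<tau>" and ?\<mu> = "\<lambda>x. (cone_radius x)\<^sup>2 / 2"
  have lev: "x \<in> level_set ?C ?\<mu> (1/2) \<longleftrightarrow> fst x = 1 \<and> snd (snd x) \<in> pts M" for x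
    by (auto simp: level_set_def mem_pts_cone cone_radius_eq power2_eq_1_iff)
  have pt: "x \<in> pts ?C" if "x \<in> level_set ?C ?\<mu> (1/2)" for x
    using that by (simp add: level_set_def)
  show ?thesis
    unfolding kaehler_quotient_def
  proof (intro conjI ballI)
    show "cone_base ` level_set ?C ?\<mu> (1/2) = pts M"
    proof
      show "pts M \<subseteq> cone_base ` level_set ?C ?\<mu> (1/2)"
      proof
        fix m assume "m \<in> pts M"
        then show "m \<in> cone_base ` level_set ?C ?\<mu> (1/2)"
          by (intro image_eqI[of _ _ "(1, 0, m)"]) (simp_all add: lev cone_base_eq)
      qed
    qed (auto simp: lev cone_base_eq)
    fix x assume x: "x \<in> level_set ?C ?\<mu> (1/2)"
    show "cone_K M \<tau> x \<noteq> 0" by (simp add: cone_K_eq[OF pt[OF x]] prod_eq_iff)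
    show "(cone_base x = cone_base y) = same_orbit ?C (cone_K M \<tau>) x y"
      if y: "y \<in> level_set ?C ?\<mu> (1/2)" for y
      using same_orbit_cone_K[OF pt[OF x] pt[OF y]] x y by (simp add: lev)
    show "dd cone_base x ` level_horizontal ?C (cone_K M \<tau>) ?\<mu> x = model M"
      by (simp add: level_horizontal_cone[OF pt[OF x]] image_image dd_cone_base)
    fix v assume "v \<in> level_horizontal ?C (cone_K M \<tau>) ?\<mu> x"
    then obtain u where v: "v = (0, \<tau> (snd (snd x)) u, u)"
      by (auto simp: level_horizontal_cone[OF pt[OF x]])
    show "cplx M (cone_base x) (dd cone_base x v) = dd cone_base x (cplx ?C x v)"
      by (cases x) (simp add: dd_cone_base v complex_cone_def, simp add: cone_base_eq)
    fix w assume "w \<in> level_horizontal ?C (cone_K M \<tau>) ?\<mu> x"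
    then obtain u' where w: "w = (0, \<tau> (snd (snd x)) u', u')"
      by (auto simp: level_horizontal_cone[OF pt[OF x]])
    show "gmet M (cone_base x) (dd cone_base x v) (dd cone_base x w) = gmet ?C x v w"
      using x by (simp add: v w dd_cone_base gmet_cone cone_form_eq lev) (simp add: cone_base_eq)
  qed (simp_all add: killing_cone_K moment_map_cone_K smooth_on_linear bounded_linear_cone_base)
qed

end

section \<open>Products of cones\<close>

text \<open>The polarised variance identity for the weights \<open>w\<close>: expand the product of
  differences and use that the total weight is 1.\<close>

lemma weighted_covariance:
  fixes w a b :: "'i::finite \<Rightarrow> real"
  assumes "(\<Sum>i\<in>UNIV. w i) = 1"
  shows "1/2 * (\<Sum>i\<in>UNIV. \<Sum>j\<in>UNIV. w i * w j * ((a i - a j) * (b i - b j)))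
    = (\<Sum>i\<in>UNIV. w i * (a i * b i)) - (\<Sum>i\<in>UNIV. w i * a i) * (\<Sum>i\<in>UNIV. w i * b i)"
proof -
  \<comment> \<open>Each summand is grouped as a function of \<open>i\<close> times a function of
    \<open>j\<close>, so that \<open>sum_product\<close> read backwards separates the double
    sums.\<close>
  have "(\<Sum>i\<in>UNIV. \<Sum>j\<in>UNIV. w i * w j * ((a i - a j) * (b i - b j)))
    = (\<Sum>i\<in>UNIV. \<Sum>j\<in>UNIV. (w i * (a i * b i)) * w j) + (\<Sum>i\<in>UNIV. \<Sum>j\<in>UNIV. w i * (w j * (a j * b j)))
      - (\<Sum>i\<in>UNIV. \<Sum>j\<in>UNIV. (w i * a i) * (w j * b j)) - (\<Sum>i\<in>UNIV. \<Sum>j\<in>UNIV. (w i * b i) * (w j * a j))"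
    by (simp add: sum.distrib[symmetric] sum_subtractf[symmetric] algebra_simps)
  also have "\<dots> = 2 * ((\<Sum>i\<in>UNIV. w i * (a i * b i))
      - (\<Sum>i\<in>UNIV. w i * a i) * (\<Sum>i\<in>UNIV. w i * b i))"
    by (simp only: sum_product[symmetric] assms) (simp add: algebra_simps)
  finally show ?thesis by simp
qed

text \<open>Squares of 1-forms are symmetric bilinear forms, so the formula is stated in polarised
  form, on pairs of vectors tangent to the level set.\<close>

theorem theorem7:
  fixes M :: "'a::euclidean_space patch"
    and \<tau> :: "'a \<Rightarrow> 'a \<Rightarrow> real"
    and \<Omega> :: "(real \<times> real \<times> 'a) set"
    and N :: "'i::finite \<Rightarrow> 'b::euclidean_space patch"
    and p :: "real \<times> real \<times> 'a \<Rightarrow> 'b ^ 'i"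
    and Mf :: "'i \<Rightarrow> 'c::euclidean_space patch"
    and \<tau>f :: "'i \<Rightarrow> 'c \<Rightarrow> 'c \<Rightarrow> real"
    and \<Omega>f :: "'i \<Rightarrow> (real \<times> real \<times> 'c) set"
    and F :: "'i \<Rightarrow> 'b \<Rightarrow> real \<times> real \<times> 'c"
  assumes base: "kaehler M" "cone_primitive M \<tau>"
    and product: "open_in_patch (complex_cone M \<tau>) \<Omega>"
      "\<And>i. kaehler (N i)"
      "kaehler_iso (restrict_patch (complex_cone M \<tau>) \<Omega>) (product_patch N) p"
    and factor_cones: "\<And>i. kaehler (Mf i)" "\<And>i. cone_primitive (Mf i) (\<tau>f i)"
      "\<And>i. open_in_patch (complex_cone (Mf i) (\<tau>f i)) (\<Omega>f i)"
      "\<And>i. kaehler_iso (N i) (restrict_patch (complex_cone (Mf i) (\<tau>f i)) (\<Omega>f i)) (F i)"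
      "\<And>i x. x \<in> \<Omega> \<Longrightarrow>
          dd (F i) (p x $ i) (factor_field p i x) = cone_field (F i (p x $ i))"
  defines "r \<equiv> factor_radius N p"
    and "\<phi> \<equiv> \<lambda>i. pull1 (\<lambda>x. F i (p x $ i)) (cone_form (\<tau>f i))"
    and "g \<equiv> \<lambda>i. pull2 (\<lambda>x. cone_base (F i (p x $ i))) (gmet (Mf i))"
  shows "kaehler_quotient (complex_cone M \<tau>) (cone_K M \<tau>) (\<lambda>x. (cone_radius x)\<^sup>2 / 2) (1/2) cone_base M
    \<and> (\<forall>x\<in>\<Omega>. cone_radius x = 1 \<longleftrightarrow> (\<Sum>i\<in>UNIV. (r i x)\<^sup>2) = 1)
    \<and> (\<forall>x\<in>\<Omega>. cone_radius x = 1 \<longrightarrow>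
         (\<forall>v\<in>level_tangent (complex_cone M \<tau>) cone_radius x. \<forall>w\<in>level_tangent (complex_cone M \<tau>) cone_radius x.
            pull2 cone_base (gmet M) x v w =
              (\<Sum>i\<in>UNIV. dd (r i) x v * dd (r i) x w)
              + 1/2 * (\<Sum>i\<in>UNIV. \<Sum>j\<in>UNIV.
                  (r i x)\<^sup>2 * (r j x)\<^sup>2 * ((\<phi> i x v - \<phi> j x v) * (\<phi> i x w - \<phi> j x w)))
              + (\<Sum>i\<in>UNIV. (r i x)\<^sup>2 * g i x v w)))"
proof -
  let ?C = "complex_cone M \<tau>" and ?CF = "\<lambda>i. complex_cone (Mf i) (\<tau>f i)"
  \<comment> \<open>\<open>G i\<close> gives the cone coordinates of the \<open>i\<close>-th factor
    as functions on the total cone; \<open>r i\<close>, \<open>\<phi> i\<close> and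
    \<open>g i\<close> are all expressed through it.\<close>
  define G where "G = (\<lambda>i x. F i (p x $ i))"
  have \<Omega>: "\<Omega> \<subseteq> pts ?C" and \<Omega>_open: "openin (top_of_set (model ?C)) \<Omega>"
    using product(1) complex_cone_patch(2)[OF base(1), of \<tau>]
    unfolding open_in_patch_def by (blast dest: openin_imp_subset, metis openin_trans)
  note V = complex_cone_patch(1)[OF base(1), of \<tau>] \<Omega>_open
  have \<Omega>f: "\<Omega>f i \<subseteq> pts (?CF i)" for i
    using factor_cones(3) openin_imp_subset unfolding open_in_patch_def by blast
  have p: "p differentiable_on \<Omega>" "\<And>x i. x \<in> \<Omega> \<Longrightarrow> p x $ i \<in> pts (N i)"
    using product(3) smooth_on_imp_differentiable_on
    by (auto simp: kaehler_iso_def restrict_patch_def complex_cone_def product_patch_def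
        dest: bij_betwE)
  have p_iso: "gmet ?C x v w =
      (\<Sum>i\<in>UNIV. gmet (N i) (p x $ i) (dd p x v $ i) (dd p x w $ i))"
    and p_cplx: "dd p x (cplx ?C x v) $ i = cplx (N i) (p x $ i) (dd p x v $ i)"
    if "x \<in> \<Omega>" "v \<in> model ?C" "w \<in> model ?C" for x v w i
    using product(3) that
    by (auto simp: kaehler_iso_def restrict_patch_def product_patch_def pull2_def)
  have F: "F i differentiable_on pts (N i)" "\<And>y. y \<in> pts (N i) \<Longrightarrow> F i y \<in> pts (?CF i)" for i
    using factor_cones(4)[of i] smooth_on_imp_differentiable_on \<Omega>f[of i]
    by (auto simp: kaehler_iso_def restrict_patch_def dest!: bij_betwE)
  have F_iso: "gmet (N i) y v w = gmet (?CF i) (F i y) (dd (F i) y v) (dd (F i) y w)"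
    and F_cplx: "dd (F i) y (cplx (N i) y v) = cplx (?CF i) (F i y) (dd (F i) y v)"
    if "y \<in> pts (N i)" "v \<in> model (N i)" "w \<in> model (N i)" for i y v w
    using factor_cones(4)[of i] that
    by (auto simp: kaehler_iso_def restrict_patch_def pull2_def)
  note ND = kaehler_imp_patch[OF product(2)]
  have G_pts: "G i x \<in> pts (?CF i)" if "x \<in> \<Omega>" for i x
    using F(2) p(2) that by (simp add: G_def)
  \<comment> \<open>The membership in \<open>model (N i)\<close> is recorded too, since
    \<open>F i\<close> is isometric and holomorphic only on such vectors.\<close>
  have chain: "\<exists>D. (G i has_derivative D) (at x within \<Omega>)
      \<and> (\<forall>v\<in>model ?C. D v = dd (F i) (p x $ i) (dd p x v $ i) \<and> dd p x v $ i \<in> model (N i))"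
    if x: "x \<in> \<Omega>" for i x
  proof (rule has_derivative_componentwise_compose[OF V ND[of i] x p(1) _ F(1)[of i], of i])
    show "p y $ i \<in> pts (N i)" if "y \<in> \<Omega>" for y using p(2) that .
  qed (auto simp: G_def)
  have dp_mem: "dd p x v $ i \<in> model (N i)" if "x \<in> \<Omega>" "v \<in> model ?C" for i x v
    using chain that by blast
  have dG: "dd (G i) x v = dd (F i) (p x $ i) (dd p x v $ i)" if "x \<in> \<Omega>" "v \<in> model ?C" for i x v
    using chain[OF that(1), of i] dd_eq[OF V that] that(2) by metis
  \<comment> \<open>Used for the radius, giving the differential of \<open>r i\<close>, and for the
    base projection, giving \<open>g i\<close>.\<close>
  have dLG: "dd (\<lambda>y. L (G i y)) x v = L (dd (G i) x v)"
    if L: "bounded_linear L" and x: "x \<in> \<Omega>" and v: "v \<in> model ?C" for L :: "real \<times> real \<times> 'c \<Rightarrow> 'd::real_normed_vector"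
      and i x v
  proof -
    obtain D where D: "(G i has_derivative D) (at x within \<Omega>)" using chain[OF x] by blast
    show ?thesis
      using dd_eq[OF V x v bounded_linear.has_derivative[OF L D]] dd_eq[OF V x v D] by simp
  qed
  have iso: "gmet ?C x v w = (\<Sum>i\<in>UNIV. gmet (?CF i) (G i x) (dd (G i) x v) (dd (G i) x w))"
    if "x \<in> \<Omega>" "v \<in> model ?C" "w \<in> model ?C" for x v w
    using p_iso[OF that] that F_iso p(2) dp_mem dG by (simp add: G_def)
  have C_mem: "cone_field x \<in> model ?C" for x
    using kaehler_imp_patch(1)[OF base(1)]
    by (simp add: cone_field_def mem_model_cone subspace_0 split: prod.splits)
  have K_mem: "(0, 1, 0) \<in> model ?C"
    using kaehler_imp_patch(1)[OF base(1)] by (simp add: mem_model_cone subspace_0)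
  have field_eq: "cone_field x = (fst x, 0, 0)" for x :: "real \<times> real \<times> 'd::real_vector"
    by (simp add: cone_field_def split: prod.splits)
  have dG_C: "dd (G i) x (cone_field x) = cone_field (G i x)" if "x \<in> \<Omega>" for i x
    using dG[OF that C_mem] factor_cones(5)[OF that] by (simp add: factor_field_def G_def)
  \<comment> \<open>On both sides \<open>(0, 1, 0)\<close> is the complex structure applied to the
    cone field; \<open>p\<close> and \<open>F i\<close> are holomorphic and match the cone
    fields.\<close>
  have dG_K: "dd (G i) x (0, 1, 0) = (0, 1, 0)" if x: "x \<in> \<Omega>" for i x
  proof -
    have J: "cplx ?C x (cone_field x) = (0, 1, 0)"
      using cplx_cone_radial[OF base, of x "fst x"] x \<Omega> by (auto simp: field_eq mem_pts_cone)
    have "dd (G i) x (0, 1, 0)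
        = dd (F i) (p x $ i) (cplx (N i) (p x $ i) (dd p x (cone_field x) $ i))"
      using dG[OF x K_mem] p_cplx[OF x C_mem[of x] C_mem[of x], unfolded J] by simp
    also have "\<dots> = cplx (?CF i) (G i x) (cone_field (G i x))"
      using F_cplx[OF p(2)[OF x] dp_mem[OF x C_mem] dp_mem[OF x C_mem]]
        dG_C[OF x] dG[OF x C_mem] by (simp add: G_def)
    also have "\<dots> = (0, 1, 0)"
      using cplx_cone_radial[OF factor_cones(1,2) G_pts[OF x]] G_pts[OF x, of i]
      by (auto simp: field_eq mem_pts_cone)
    finally show ?thesis .
  qed
  have r_eq: "r i x = fst (G i x)" if x: "x \<in> \<Omega>" for i x
  proof -
    have "gmet (N i) (p x $ i) (factor_field p i x) (factor_field p i x)
        = gmet (?CF i) (G i x) (cone_field (G i x)) (cone_field (G i x))"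
      using F_iso[OF p(2)[OF x] dp_mem[OF x C_mem] dp_mem[OF x C_mem]] factor_cones(5)[OF x]
      by (simp add: factor_field_def G_def)
    also have "\<dots> = (fst (G i x))\<^sup>2"
      using gmet_cone_radial[OF factor_cones(1,2) G_pts[OF x]]
      by (simp add: field_eq power2_eq_square)
    finally show ?thesis
      using G_pts[OF x, of i] by (simp add: r_def factor_radius_def mem_pts_cone)
  qed
  \<comment> \<open>\<open>r_eq\<close> holds only on \<open>\<Omega>\<close>, which is relatively
    open, so it may be differentiated there.\<close>
  have dr: "dd (r i) x v = fst (dd (G i) x v)" if "x \<in> \<Omega>" "v \<in> model ?C" for i x v
    using dd_cong_on[OF V that r_eq] dLG[OF bounded_linear_fst that] by simp
  have \<phi>_eq: "\<phi> i x v = cone_form (\<tau>f i) (G i x) (dd (G i) x v)" for i x v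
    by (simp add: \<phi>_def pull1_def G_def)
  have g_eq: "g i x v w = gmet (Mf i) (snd (snd (G i x)))
      (snd (snd (dd (G i) x v))) (snd (snd (dd (G i) x w)))"
    if "x \<in> \<Omega>" "v \<in> model ?C" "w \<in> model ?C" for i x v w
    using dLG[OF bounded_linear_cone_base that(1,2)] dLG[OF bounded_linear_cone_base that(1,3)]
    by (simp add: g_def pull2_def G_def cone_base_eq)
  \<comment> \<open>Both sides are the squared length of the cone field, computed in the total cone
    and in the product.\<close>
  have radius: "(fst x)\<^sup>2 = (\<Sum>i\<in>UNIV. (r i x)\<^sup>2)" if x: "x \<in> \<Omega>" for x
  proof -
    have "(fst x)\<^sup>2 = gmet ?C x (cone_field x) (cone_field x)"
      using gmet_cone_radial[OF base, of x] x \<Omega> by (auto simp: field_eq power2_eq_square)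
    also have "\<dots> = (\<Sum>i\<in>UNIV. (r i x)\<^sup>2)"
      using iso[OF x C_mem C_mem] dG_C[OF x] r_eq[OF x]
        gmet_cone_radial[OF factor_cones(1,2) G_pts[OF x]]
      by (simp add: field_eq power2_eq_square)
    finally show ?thesis .
  qed
  \<comment> \<open>Both sides are the pairing of \<open>v\<close> with \<open>K\<close>, whose
    components are the fields \<open>(0, 1, 0)\<close> of the factors.\<close>
  have form: "(fst x)\<^sup>2 * cone_form \<tau> x v = (\<Sum>i\<in>UNIV. (r i x)\<^sup>2 * \<phi> i x v)"
    if x: "x \<in> \<Omega>" and v: "v \<in> model ?C" for x v
  proof -
    have "(fst x)\<^sup>2 * cone_form \<tau> x v = gmet ?C x v (0, 1, 0)"
      using gmet_cone_vertical[OF base, of x v 1] x \<Omega> by auto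
    also have "\<dots> = (\<Sum>i\<in>UNIV. (r i x)\<^sup>2 * \<phi> i x v)"
      using iso[OF x v K_mem] dG_K[OF x] r_eq[OF x] \<phi>_eq
        gmet_cone_vertical[OF factor_cones(1,2) G_pts[OF x]] by simp
    finally show ?thesis .
  qed
  have metric: "pull2 cone_base (gmet M) x v w =
      (\<Sum>i\<in>UNIV. dd (r i) x v * dd (r i) x w)
      + 1/2 * (\<Sum>i\<in>UNIV. \<Sum>j\<in>UNIV.
          (r i x)\<^sup>2 * (r j x)\<^sup>2 * ((\<phi> i x v - \<phi> j x v) * (\<phi> i x w - \<phi> j x w)))
      + (\<Sum>i\<in>UNIV. (r i x)\<^sup>2 * g i x v w)"
    if x: "x \<in> \<Omega>" and 1: "cone_radius x = 1"
      and v: "v \<in> level_tangent ?C cone_radius x" and w: "w \<in> level_tangent ?C cone_radius x"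
    for x v w
  proof -
    have v: "v \<in> model ?C" "fst v = 0" and w: "w \<in> model ?C" "fst w = 0"
      using v w by (auto simp: level_tangent_def dd_cone_radius)
    have x1: "fst x = 1" using 1 by (simp add: cone_radius_eq)
    have "cone_form \<tau> x v * cone_form \<tau> x w + pull2 cone_base (gmet M) x v w = gmet ?C x v w"
      using x1 v w by (simp add: gmet_cone pull2_def dd_cone_base) (simp add: cone_base_eq)
    also have "\<dots> = (\<Sum>i\<in>UNIV. dd (r i) x v * dd (r i) x w
        + (r i x)\<^sup>2 * (\<phi> i x v * \<phi> i x w) + (r i x)\<^sup>2 * g i x v w)"
      using iso[OF x v(1) w(1)] dr[OF x v(1)] dr[OF x w(1)] r_eq[OF x] \<phi>_eq
        g_eq[OF x v(1) w(1)]
      by (simp add: gmet_cone algebra_simps)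
    finally have *: "cone_form \<tau> x v * cone_form \<tau> x w + pull2 cone_base (gmet M) x v w
      = (\<Sum>i\<in>UNIV. dd (r i) x v * dd (r i) x w)
        + (\<Sum>i\<in>UNIV. (r i x)\<^sup>2 * (\<phi> i x v * \<phi> i x w)) + (\<Sum>i\<in>UNIV. (r i x)\<^sup>2 * g i x v w)"
      by (simp only: sum.distrib)
    have "(\<Sum>i\<in>UNIV. (r i x)\<^sup>2) = 1" using radius[OF x] x1 by simp
    note cov = weighted_covariance[OF this, of "\<lambda>i. \<phi> i x v" "\<lambda>i. \<phi> i x w"]
    have "cone_form \<tau> x v = (\<Sum>i\<in>UNIV. (r i x)\<^sup>2 * \<phi> i x v)"
      "cone_form \<tau> x w = (\<Sum>i\<in>UNIV. (r i x)\<^sup>2 * \<phi> i x w)"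
      using form[OF x v(1)] form[OF x w(1)] x1 by simp_all
    \<comment> \<open>Moving the product of the total 1-forms to the other side leaves a weighted
      second moment minus a product of weighted means.\<close>
    with * show ?thesis unfolding cov by (simp add: algebra_simps)
  qed
  \<comment> \<open>Positivity of the radius excludes the root -1.\<close>
  have "cone_radius x = 1 \<longleftrightarrow> (\<Sum>i\<in>UNIV. (r i x)\<^sup>2) = 1" if x: "x \<in> \<Omega>" for x
    using radius[OF x] \<Omega> x by (auto simp: cone_radius_eq mem_pts_cone power2_eq_1_iff)
  then show ?thesis
    using kaehler_quotient_cone[OF base] metric by blast
qed

end
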